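(* Let $\mathcal{A}$ be a unital $C^*$-algebra, let $\mathcal{F}\subseteq\mathcal{A}$ be an ideal of finite type elements, and let $a\in\mathcal{A}$. Then the following holds. 1) If $a$ is an upper semi-Fredholm element and $\tilde p$ is a projection in $\mathcal{A}$ such that $a\tilde p=0$, then $\tilde p\in\mathcal{F}$. In particular, if $p,q$ are projections in $\mathcal{A}$ such that $a$ is invertible up to $(p,q)$ and $(1-q)a(1-p)=a$, then $a$ is an upper semi-Fredholm element if and only if $p\in\mathcal{F}$. 2) If $a$ is a lower semi-Fredholm element and $\tilde q$ is a projection in $\mathcal{A}$ such that $\tilde q a=0$, then $\tilde q\in\mathcal{F}$. In particular, if $p,q$ are projections in $\mathcal{A}$ such that $a$ is invertible up to $(p,q)$ and $(1-q)a(1-p)=a$, then $a$ is a lower semi-Fredholm element if and only if $q\in\mathcal{F}$.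
   Context: Ideal of finite type elements: a subalgebra $\mathcal{F}\subseteq\mathcal{A}$ such that (i) $\mathcal{F}$ is a selfadjoint ideal: $ab,ba\in\mathcal{F}$ for all $a\in\mathcal{A}$, $b\in\mathcal{F}$, and $a\in\mathcal{F}$ implies $a^*\in\mathcal{F}$; (ii) there is an approximate unit $(p_\alpha)$ (in the norm topology) for $\mathcal{F}$ consisting of projections; (iii) if $p,q\in\mathcal{F}$ are projections, then there exists $v\in\mathcal{A}$ such that $vv^*=q$ and $v^*v\perp p$, i.e. $v^*v+p$ is a projection. For $a\in\mathcal{A}$ and projections $p,q\in\mathcal{A}$, $a$ is invertible up to the pair $(p,q)$ if, with $a'=(1-q)a(1-p)$, there is $b\in\mathcal{A}$ with $b=(1-p)b(1-q)$, $a'b=1-q$, $ba'=1-p$. $a$ is an upper (resp. lower) semi-Fredholm element with respect to $\mathcal{F}$ if $a$ is invertible up to some pair $(p,q)$ of projections in $\mathcal{A}$ with $p\in\mathcal{F}$ (resp. $q\in\mathcal{F}$). *)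

theory Defs
  imports "HOL-Analysis.Analysis"
begin

text \<open>Unital (complex) C*-algebras. The unit is required through \<^class>\<open>monoid_mult\<close> rather than
  \<^class>\<open>real_normed_algebra_1\<close>, so the zero algebra is not excluded; in a nonzero algebra
  \<open>norm 1 = 1\<close> follows from the C*-identity.\<close>

class unital_cstar_algebra = real_normed_algebra + banach + monoid_mult +
  fixes scaleC :: "complex \<Rightarrow> 'a \<Rightarrow> 'a"
    and star :: "'a \<Rightarrow> 'a"
  assumes scaleC_add_right: "scaleC c (x + y) = scaleC c x + scaleC c y"
    and scaleC_add_left: "scaleC (c + d) x = scaleC c x + scaleC d x"
    and scaleC_scaleC: "scaleC c (scaleC d x) = scaleC (c * d) x"
    and scaleC_of_real: "scaleC (complex_of_real r) x = scaleR r x"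
    and mult_scaleC_left: "scaleC c x * y = scaleC c (x * y)"
    and mult_scaleC_right: "x * scaleC c y = scaleC c (x * y)"
    and norm_scaleC: "norm (scaleC c x) = cmod c * norm x"
    and star_star: "star (star x) = x"
    and star_add: "star (x + y) = star x + star y"
    and star_scaleC: "star (scaleC c x) = scaleC (cnj c) (star x)"
    and star_mult: "star (x * y) = star y * star x"
    and cstar_identity: "norm (star x * x) = (norm x)\<^sup>2"

definition is_projection :: "'a::unital_cstar_algebra \<Rightarrow> bool" where
  "is_projection p \<longleftrightarrow> p * p = p \<and> star p = p"

definition subalgebra :: "'a::unital_cstar_algebra set \<Rightarrow> bool" where
  "subalgebra F \<longleftrightarrow> 0 \<in> F \<and> (\<forall>x\<in>F. \<forall>y\<in>F. x + y \<in> F \<and> x * y \<in> F)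
     \<and> (\<forall>c. \<forall>x\<in>F. scaleC c x \<in> F)"

definition selfadjoint_ideal :: "'a::unital_cstar_algebra set \<Rightarrow> bool" where
  "selfadjoint_ideal F \<longleftrightarrow> (\<forall>a. \<forall>b\<in>F. a * b \<in> F \<and> b * a \<in> F) \<and> (\<forall>a\<in>F. star a \<in> F)"

definition directed_set :: "'i set \<Rightarrow> ('i \<Rightarrow> 'i \<Rightarrow> bool) \<Rightarrow> bool" where
  "directed_set I le \<longleftrightarrow> I \<noteq> {} \<and> (\<forall>i\<in>I. le i i)
     \<and> (\<forall>i\<in>I. \<forall>j\<in>I. \<forall>k\<in>I. le i j \<longrightarrow> le j k \<longrightarrow> le i k)
     \<and> (\<forall>i\<in>I. \<forall>j\<in>I. \<exists>k\<in>I. le i k \<and> le j k)"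

definition tails :: "'i set \<Rightarrow> ('i \<Rightarrow> 'i \<Rightarrow> bool) \<Rightarrow> 'i filter" where
  "tails I le = (INF i\<in>I. principal {j\<in>I. le i j})"

text \<open>The net is not required to be increasing.\<close>

definition approximate_unit ::
    "'i set \<Rightarrow> ('i \<Rightarrow> 'i \<Rightarrow> bool) \<Rightarrow> ('i \<Rightarrow> 'a::unital_cstar_algebra) \<Rightarrow> 'a set \<Rightarrow> bool" where
  "approximate_unit I le u F \<longleftrightarrow> directed_set I le \<and> (\<forall>i\<in>I. u i \<in> F)
     \<and> (\<forall>x\<in>F. ((\<lambda>i. x * u i) \<longlongrightarrow> x) (tails I le) \<and> ((\<lambda>i. u i * x) \<longlongrightarrow> x) (tails I le))"

text \<open>HOL cannot quantify over the type of the indices of a net inside a definition, so this type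
  is passed as a parameter. A theorem assuming \<open>finite_type_ideal TYPE('i) F\<close> with \<open>'i\<close> free
  covers approximate units indexed by arbitrary directed sets.\<close>

definition finite_type_ideal :: "'i itself \<Rightarrow> 'a::unital_cstar_algebra set \<Rightarrow> bool" where
  "finite_type_ideal _ F \<longleftrightarrow> subalgebra F \<and> selfadjoint_ideal F
     \<and> (\<exists>(I::'i set) le u. approximate_unit I le u F \<and> (\<forall>i\<in>I. is_projection (u i)))
     \<and> (\<forall>p\<in>F. \<forall>q\<in>F. is_projection p \<longrightarrow> is_projection q \<longrightarrow>
          (\<exists>v. v * star v = q \<and> is_projection (star v * v + p)))"

definition invertible_up_to :: "'a::unital_cstar_algebra \<Rightarrow> 'a \<Rightarrow> 'a \<Rightarrow> bool" where
  "invertible_up_to a p q \<longleftrightarrow>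
     (let a' = (1 - q) * a * (1 - p) in
       \<exists>b. b = (1 - p) * b * (1 - q) \<and> a' * b = 1 - q \<and> b * a' = 1 - p)"

definition upper_semi_Fredholm :: "'a::unital_cstar_algebra set \<Rightarrow> 'a \<Rightarrow> bool" where
  "upper_semi_Fredholm F a \<longleftrightarrow>
     (\<exists>p q. is_projection p \<and> is_projection q \<and> p \<in> F \<and> invertible_up_to a p q)"

definition lower_semi_Fredholm :: "'a::unital_cstar_algebra set \<Rightarrow> 'a \<Rightarrow> bool" where
  "lower_semi_Fredholm F a \<longleftrightarrow>
     (\<exists>p q. is_projection p \<and> is_projection q \<and> q \<in> F \<and> invertible_up_to a p q)"

end

theory Submission
  imports Defs
begin

text \<open>If \<open>b = b (1 - q)\<close> inverts \<open>a\<close> up to \<open>(p, q)\<close>, then \<open>b a (1 - p) = 1 - p\<close>, that is,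
  \<open>1 - b a = (1 - b a) p\<close>. Hence \<open>a p' = 0\<close> gives \<open>p' = (1 - b a) p p'\<close>, which lies in any
  ideal containing \<open>p\<close>. The lower case is the mirror image, starting from \<open>(1 - q) a b = 1 - q\<close>.\<close>

lemma invertible_up_to_left_factor:
  assumes "invertible_up_to a p q"
  obtains b where "1 - b * a = (1 - b * a) * p"
proof -
  obtain b where "b * ((1 - q) * a * (1 - p)) = 1 - p"
    using assms unfolding invertible_up_to_def Let_def by blast
  \<comment> \<open>The witness \<open>c = b * (1 - q)\<close> absorbs the left cut-off of
    \<open>a\<close>, so the equation becomes \<open>(1 - c * a) * (1 - p) = 0\<close>.\<close>
  then have "1 - b * (1 - q) * a = (1 - b * (1 - q) * a) * p"
    by (simp add: algebra_simps)
  then show thesis by (rule that)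
qed

lemma invertible_up_to_right_factor:
  assumes "invertible_up_to a p q"
  obtains b where "1 - a * b = q * (1 - a * b)"
proof -
  obtain b where "(1 - q) * a * (1 - p) * b = 1 - q"
    using assms unfolding invertible_up_to_def Let_def by blast
  \<comment> \<open>Here \<open>c = (1 - p) * b\<close> absorbs the right cut-off, giving
    \<open>(1 - q) * (1 - a * c) = 0\<close>.\<close>
  then have "1 - a * ((1 - p) * b) = q * (1 - a * ((1 - p) * b))"
    by (simp add: algebra_simps)
  then show thesis by (rule that)
qed

lemma upper_semi_Fredholm_right_annihilator:
  assumes "selfadjoint_ideal F" "upper_semi_Fredholm F a" "a * x = 0"
  shows "x \<in> F"
proof -
  obtain p q where "p \<in> F" and inv: "invertible_up_to a p q"
    using assms(2) unfolding upper_semi_Fredholm_def by blast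
  obtain b where b: "1 - b * a = (1 - b * a) * p"
    using inv by (rule invertible_up_to_left_factor)
  have "x = (1 - b * a) * x"
    using assms(3) by (simp add: left_diff_distrib mult.assoc)
  also have "\<dots> = (1 - b * a) * p * x"
    using b by simp
  \<comment> \<open>\<open>p\<close> is an inner factor of \<open>x\<close>, so both sides of the
    ideal property are used.\<close>
  finally show ?thesis
    using assms(1) \<open>p \<in> F\<close> unfolding selfadjoint_ideal_def by metis
qed

lemma lower_semi_Fredholm_left_annihilator:
  assumes "selfadjoint_ideal F" "lower_semi_Fredholm F a" "x * a = 0"
  shows "x \<in> F"
proof -
  obtain p q where "q \<in> F" and inv: "invertible_up_to a p q"
    using assms(2) unfolding lower_semi_Fredholm_def by blast
  obtain b where b: "1 - a * b = q * (1 - a * b)"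
    using inv by (rule invertible_up_to_right_factor)
  have "x = x * (1 - a * b)"
    using assms(3) by (simp add: right_diff_distrib flip: mult.assoc)
  also have "\<dots> = x * (q * (1 - a * b))"
    using b by simp
  finally show ?thesis
    using assms(1) \<open>q \<in> F\<close> unfolding selfadjoint_ideal_def by metis
qed

text \<open>Since \<open>1 - p\<close> kills \<open>p\<close> and \<open>1 - q\<close> kills
  \<open>q\<close>, the annihilator lemmas apply to \<open>p\<close> and \<open>q\<close>
  themselves; this gives the forward directions of the two equivalences.\<close>

lemma compression_annihilates:
  assumes "is_projection p" "is_projection q" "(1 - q) * a * (1 - p) = a"
  shows "a * p = 0" "q * a = 0"
proof -
  have "(1 - p) * p = 0" "q * (1 - q) = 0"
    using assms(1,2) by (simp_all add: is_projection_def algebra_simps)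
  then show "a * p = 0" "q * a = 0"
    using assms(3) by (metis mult.assoc mult_zero_right, metis mult.assoc mult_zero_left)
qed

theorem lemma3p9:
  fixes F :: "'a::unital_cstar_algebra set" and a :: 'a
  assumes "finite_type_ideal TYPE('i) F"
  shows "(\<forall>p'. upper_semi_Fredholm F a \<longrightarrow> is_projection p' \<longrightarrow> a * p' = 0 \<longrightarrow> p' \<in> F)
    \<and> (\<forall>p q. is_projection p \<longrightarrow> is_projection q \<longrightarrow> invertible_up_to a p q \<longrightarrow>
          (1 - q) * a * (1 - p) = a \<longrightarrow> (upper_semi_Fredholm F a \<longleftrightarrow> p \<in> F))
    \<and> (\<forall>q'. lower_semi_Fredholm F a \<longrightarrow> is_projection q' \<longrightarrow> q' * a = 0 \<longrightarrow> q' \<in> F)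
    \<and> (\<forall>p q. is_projection p \<longrightarrow> is_projection q \<longrightarrow> invertible_up_to a p q \<longrightarrow>
          (1 - q) * a * (1 - p) = a \<longrightarrow> (lower_semi_Fredholm F a \<longleftrightarrow> q \<in> F))"
proof -
  have F: "selfadjoint_ideal F"
    using assms by (simp add: finite_type_ideal_def)
  note upper = upper_semi_Fredholm_right_annihilator[OF F]
  note lower = lower_semi_Fredholm_left_annihilator[OF F]
  show ?thesis
  proof (intro conjI allI impI)
    fix p q
    assume pq: "is_projection p" "is_projection q" "invertible_up_to a p q"
      "(1 - q) * a * (1 - p) = a"
    note ann = compression_annihilates[OF pq(1,2,4)]
    show "upper_semi_Fredholm F a \<longleftrightarrow> p \<in> F"
      \<comment> \<open>For the converse, the given pair \<open>(p, q)\<close> itself witnesses the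
        semi-Fredholm property; likewise in the lower case.\<close>
      using pq(1-3) upper[OF _ ann(1)] unfolding upper_semi_Fredholm_def by blast
    show "lower_semi_Fredholm F a \<longleftrightarrow> q \<in> F"
      using pq(1-3) lower[OF _ ann(2)] unfolding lower_semi_Fredholm_def by blast
  qed (use upper lower in blast)+
qed

end
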